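(* For all integers $n\ge0$ and $r\ge m\ge0$, $$\sum_{k=0}^{n}\binom{r+k}{m}\binom{r+k-m}{k}\binom{2r+2k}{r+k}\binom{2n-2k}{n-k}=4^{n}\binom{n+r}{m}\binom{2r}{r}\binom{n+r-m}{n}.$$ *)

theory Defs
  imports Complex_Main
begin

end

theory Submission
  imports Defs
begin

text \<open>
  Both sides are multiples of \<open>r choose m\<close>, since a trinomial coefficient can be split into
  binomial coefficients in two ways (\<open>choose_split_exchange\<close>). Cancelling this factor leaves
  the case \<open>m = 0\<close>, which is the comparison of the coefficients of \<open>x ^ n\<close> in
  \[(1 - 4 x)^{-(r + 1/2)} \cdot (1 - 4 x)^{-1/2} = (1 - 4 x)^{-(r + 1)}.\]
  Written with rising factorials, these coefficients are \<open>4 ^ k * pochhammer (r + 1/2) k / fact k\<close>,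
  and similarly for the other exponents. The lemma \<open>central_binomial_shift\<close> recognises them in
  the summand, and the Chu-Vandermonde identity for rising factorials (\<open>pochhammer_binomial_sum\<close>)
  evaluates the convolution.
\<close>

text \<open>Both sides count the ordered pairs of disjoint subsets, of sizes \<open>m\<close> and \<open>k\<close>, of a set with
  \<open>r + k\<close> elements; they differ in which subset is chosen first.\<close>

lemma choose_split_exchange:
  assumes "m \<le> r"
  shows "((r + k) choose m) * ((r + k - m) choose k) = ((r + k) choose k) * (r choose m)"
proof -
  have "((r + k) choose m) * ((r + k - m) choose k)
      = ((r + k) choose (m + k)) * ((m + k) choose m)"
    using choose_mult[of m "m + k" "r + k"] assms by simp
  also have "(m + k) choose m = (m + k) choose k"
    using binomial_symmetric[of m "m + k"] by simp
  also have "((r + k) choose (m + k)) * ((m + k) choose k) = ((r + k) choose k) * (r choose m)"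
    using choose_mult[of k "m + k" "r + k"] assms by simp
  finally show ?thesis .
qed

lemma central_binomial_pochhammer:
  "of_nat ((2 * n) choose n) * fact n = (4 ^ n * pochhammer (1 / 2) n :: 'a :: field_char_0)"
proof -
  have "(of_nat ((2 * n) choose n) :: 'a) = fact (2 * n) / (fact n * fact n)"
    using binomial_fact[of n "2 * n"] by simp
  then show ?thesis
    by (simp add: fact_double power_mult)
qed

text \<open>The left-hand side without \<open>fact k\<close> is, up to the constant \<open>(2 * r) choose r\<close>, the coefficient
  of \<open>x ^ k\<close> in \<open>(1 - 4 x)\<close> to the power \<open>- (r + 1/2)\<close>. The shift by \<open>r\<close> arises because
  \<open>pochhammer (1 / 2) (r + k)\<close> factors after its first \<open>r\<close> terms.\<close>

lemma central_binomial_shift: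
  "of_nat ((r + k) choose k) * of_nat ((2 * r + 2 * k) choose (r + k)) * fact k
    = (of_nat ((2 * r) choose r) * (4 ^ k * pochhammer (of_nat r + 1 / 2) k) :: 'a :: field_char_0)"
    (is "?L = ?R")
proof -
  have choose: "of_nat ((r + k) choose k) * fact k * fact r = (fact (r + k) :: 'a)"
    using binomial_fact[of k "r + k", where 'a = 'a] by simp
  have "?L * fact r
      = of_nat ((2 * (r + k)) choose (r + k)) * (of_nat ((r + k) choose k) * fact k * fact r)"
    by (simp add: algebra_simps)
  also have "\<dots> = 4 ^ (r + k) * pochhammer (1 / 2) (r + k)"
    unfolding choose by (rule central_binomial_pochhammer)
  also have "\<dots> = (4 ^ r * pochhammer (1 / 2) r) * (4 ^ k * pochhammer (of_nat r + 1 / 2) k)"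
    by (simp add: pochhammer_product'[of _ r k] power_add add.commute[of "1 / 2"] mult_ac)
  also have "\<dots> = ?R * fact r"
    unfolding central_binomial_pochhammer[symmetric] by (simp add: mult_ac)
  finally show ?thesis
    by simp
qed

lemma central_binomial_convolution:
  "(\<Sum>k\<le>n. ((r + k) choose k) * ((2 * r + 2 * k) choose (r + k)) * ((2 * (n - k)) choose (n - k)))
    = 4 ^ n * ((2 * r) choose r) * ((n + r) choose n)" (is "sum ?f _ = ?R")
proof -
  have summand: "real (?f k) * fact n = 4 ^ n * real ((2 * r) choose r) *
      (real (n choose k) * pochhammer (real r + 1 / 2) k * pochhammer (1 / 2) (n - k))"
    if "k \<le> n" for k
  proof -
    have "fact n = fact k * fact (n - k) * real (n choose k)"
      using binomial_fact_lemma[OF that] by (metis of_nat_fact of_nat_mult)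
    then have "real (?f k) * fact n = real (n choose k) *
        (real ((r + k) choose k) * real ((2 * r + 2 * k) choose (r + k)) * fact k) *
        (real ((2 * (n - k)) choose (n - k)) * fact (n - k))"
      by (simp add: mult_ac)
    also have "\<dots> = real (n choose k) *
        (real ((2 * r) choose r) * (4 ^ k * pochhammer (real r + 1 / 2) k)) *
        (4 ^ (n - k) * pochhammer (1 / 2) (n - k))"
      unfolding central_binomial_shift central_binomial_pochhammer ..
    also have "\<dots> = (4 ^ k * 4 ^ (n - k)) * real ((2 * r) choose r) *
        (real (n choose k) * pochhammer (real r + 1 / 2) k * pochhammer (1 / 2) (n - k))"
      by (simp add: mult_ac)
    finally show ?thesis
      using that by (simp flip: power_add)
  qed
  have rising: "pochhammer (real r + 1) n = real ((n + r) choose n) * fact n"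
  proof -
    have "fact r * pochhammer (real r + 1) n = fact (r + n)"
      by (simp add: pochhammer_fact pochhammer_product'[of _ r n] add.commute[of _ 1])
    also have "\<dots> = fact r * (real ((n + r) choose n) * fact n)"
      using binomial_fact[of n "n + r", where 'a = real] by (simp add: add.commute)
    finally show ?thesis
      by simp
  qed
  have "real (sum ?f {..n}) * fact n = (\<Sum>k\<le>n. real (?f k) * fact n)"
    by (simp only: of_nat_sum sum_distrib_right)
  also have "\<dots> = 4 ^ n * real ((2 * r) choose r) *
      (\<Sum>k\<le>n. real (n choose k) * pochhammer (real r + 1 / 2) k * pochhammer (1 / 2) (n - k))"
    unfolding sum_distrib_left by (rule sum.cong) (simp_all only: summand atMost_iff)
  also have "\<dots> = 4 ^ n * real ((2 * r) choose r) * pochhammer (real r + 1) n"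
    using pochhammer_binomial_sum[of "real r + 1 / 2" "1 / 2" n] by (simp add: add.assoc)
  also have "\<dots> = real ?R * fact n"
    unfolding rising by simp
  finally have "real (sum ?f {..n}) = real ?R"
    by simp
  then show ?thesis
    by (simp only: of_nat_eq_iff)
qed

theorem mainTheorem16:
  fixes n r m :: nat
  assumes "m \<le> r"
  shows "(\<Sum>k=0..n. ((r + k) choose m) * ((r + k - m) choose k) *
            ((2 * r + 2 * k) choose (r + k)) * ((2 * n - 2 * k) choose (n - k)))
         = 4 ^ n * ((n + r) choose m) * ((2 * r) choose r) * ((n + r - m) choose n)"
    (is "?L = ?R")
proof -
  have "?L = (r choose m) * (\<Sum>k\<le>n. ((r + k) choose k) *
      ((2 * r + 2 * k) choose (r + k)) * ((2 * (n - k)) choose (n - k)))"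
    unfolding choose_split_exchange[OF assms] sum_distrib_left atMost_atLeast0
    by (simp only: mult_ac diff_mult_distrib)
  also have "\<dots> = 4 ^ n * ((2 * r) choose r) * (((n + r) choose n) * (r choose m))"
    unfolding central_binomial_convolution by (simp add: mult_ac)
  also have "\<dots> = ?R"
    using choose_split_exchange[OF assms, of n] by (simp add: add.commute mult_ac)
  finally show ?thesis .
qed

end
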